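(* Let $d\ge 2$ be an integer, let $0<\alpha<1$, and let $\Gamma=\{(t,t^2,\ldots,t^d): t\in[0,1]\}$ be the moment curve. For any complex sequence $\mathbf{a}=(a_n)_{n=1}^\infty$ with $a_n=n^{o(1)}$ as $n\to\infty$ we have $$\dim(\mathcal{E}_{\mathbf{a},d,\alpha}\cap\Gamma)\le 1-\frac{2\alpha-1}{d+1-\alpha}.$$
   Context: $\dim$ is Hausdorff dimension, $\mathbf{e}(x)=\exp(2\pi i x)$, and $\mathsf{T}_d=(\mathbb{R}/\mathbb{Z})^d$ is identified with $[0,1)^d$. $S_{\mathbf{a},d}(\mathbf{x};N)=\sum_{n=1}^N a_n\,\mathbf{e}(x_1n+x_2n^2+\ldots+x_dn^d)$ and $\mathcal{E}_{\mathbf{a},d,\alpha}=\{\mathbf{x}\in\mathsf{T}_d: |S_{\mathbf{a},d}(\mathbf{x};N)|\ge N^{\alpha}\text{ for infinitely many }N\in\mathbb{N}\}$, defined for $0<\alpha<1$. $U=V^{o(1)}$ means that for every $\varepsilon>0$, $|U|\le V^{\varepsilon}$ once $V$ is large enough. *)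

theory Defs
  imports "HOL-Analysis.Analysis"
begin

text \<open>
  The contribution \<open>(diam U)\<^sup>s\<close> of a covering set. The cases are needed because
  \<open>0 powr 0 = 0\<close> in HOL: for \<open>s = 0\<close> a nonempty set has to count as 1, and the empty set
  always counts as 0 (so that finite covers are sequences padded with empty sets).
\<close>

definition diam_power :: "real \<Rightarrow> 'a::metric_space set \<Rightarrow> ennreal" where
  "diam_power s U =
     (if U = {} then 0 else if s = 0 then 1 else ennreal (diameter U powr s))"

text \<open>Boundedness is required explicitly, since \<^const>\<open>diameter\<close> is unspecified on
  unbounded sets.\<close>

definition hausdorff_premeasure :: "real \<Rightarrow> real \<Rightarrow> 'a::metric_space set \<Rightarrow> ennreal" where
  "hausdorff_premeasure s \<delta> A =
     (INF U \<in> {U :: nat \<Rightarrow> 'a set.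
                 A \<subseteq> (\<Union>i. U i) \<and> (\<forall>i. bounded (U i) \<and> diameter (U i) \<le> \<delta>)}.
        \<Sum>i. diam_power s (U i))"

definition hausdorff_measure :: "real \<Rightarrow> 'a::metric_space set \<Rightarrow> ennreal" where
  "hausdorff_measure s A = (SUP \<delta>\<in>{0<..}. hausdorff_premeasure s \<delta> A)"

definition hausdorff_dim :: "'a::metric_space set \<Rightarrow> ereal" where
  "hausdorff_dim A = (INF s \<in> {s. 0 \<le> s \<and> hausdorff_measure s A = 0}. ereal s)"

text \<open>
  Points of \<open>\<real>\<^sup>d\<close> are vectors over a finite linearly ordered index type with \<open>d\<close> elements;
  \<open>coord_pos\<close> numbers the coordinates \<open>1, \<dots>, d\<close> in increasing order.
\<close>

definition coord_pos :: "'n::{finite,linorder} \<Rightarrow> nat" where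
  "coord_pos i = card {j. j \<le> i}"

definition e_fun :: "real \<Rightarrow> complex" where
  "e_fun x = exp (2 * of_real pi * \<i> * of_real x)"

definition weyl_sum ::
    "(nat \<Rightarrow> complex) \<Rightarrow> real ^ ('n::{finite,linorder}) \<Rightarrow> nat \<Rightarrow> complex" where
  "weyl_sum a x N =
     (\<Sum>n = 1..N. a n * e_fun (\<Sum>i\<in>UNIV. x $ i * real n ^ coord_pos i))"

definition unit_torus :: "(real ^ 'n) set" where
  "unit_torus = {x. \<forall>i. 0 \<le> x $ i \<and> x $ i < 1}"

definition large_weyl_set ::
    "(nat \<Rightarrow> complex) \<Rightarrow> real \<Rightarrow> (real ^ ('n::{finite,linorder})) set" where
  "large_weyl_set a \<alpha> =
     {x \<in> unit_torus. infinite {N. 1 \<le> N \<and> real N powr \<alpha> \<le> norm (weyl_sum a x N)}}"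

text \<open>
  The endpoint \<open>t = 1\<close> gives \<open>(1, \<dots>, 1)\<close>, which lies outside \<open>[0,1)\<^sup>d\<close>; modulo 1 it is the
  point with \<open>t = 0\<close>, so intersecting the curve with a subset of \<open>[0,1)\<^sup>d\<close> loses nothing.
\<close>

definition moment_curve :: "(real ^ ('n::{finite,linorder})) set" where
  "moment_curve = (\<lambda>t. \<chi> i. t ^ coord_pos i) ` {0..1}"

text \<open>The condition written \<open>a_n = n^{o(1)}\<close> as \<open>n \<rightarrow> \<infinity>\<close>.\<close>

definition subpolynomial :: "(nat \<Rightarrow> complex) \<Rightarrow> bool" where
  "subpolynomial a \<longleftrightarrow>
     (\<forall>\<epsilon>>0. \<forall>\<^sub>F n in sequentially. norm (a n) \<le> real n powr \<epsilon>)"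

end

theory Submission
  imports Defs "HOL-Real_Asymp.Real_Asymp"
begin

text \<open>
  Along the moment curve the phases of distinct \<open>n > m\<close> differ by a function of \<open>t\<close> with increasing
  derivative at least \<open>n - m\<close>, so van der Corput's first derivative test makes the exponentials almost
  orthogonal, and a sum over a block of length \<open>H\<close> below \<open>N\<close> has mean square at most \<open>H N\<^bsup>o(1)\<^esup>\<close>.
  A partial sum of length below \<open>N = 2\<^sup>K\<close> splits into at most \<open>K\<close> dyadic blocks, so if it exceeds about
  \<open>N\<^sup>\<alpha>\<close>, then some block exceeds \<open>N\<^bsup>\<alpha> - o(1)\<^esup>\<close>. Since a block has derivative at most
  \<open>N\<^bsup>d + 1 + o(1)\<^esup>\<close>, it stays large on an interval of length \<open>1 / L = N\<^bsup>- (d + 1 - \<alpha>) - o(1)\<^esup>\<close>. Hence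
  \<open>L N\<^bsup>1 - 2 \<alpha> + o(1)\<^esup>\<close> such intervals contain all large values at scale \<open>N\<close>, and the resulting
  \<open>s\<close>-dimensional cost \<open>L\<^bsup>1 - s\<^esup> N\<^bsup>1 - 2 \<alpha> + o(1)\<^esup>\<close> is summable over \<open>K\<close> for every \<open>s\<close> above the
  claimed bound.
\<close>

section \<open>Exponentials and the first derivative test\<close>

lemma e_fun_altdef: "e_fun x = exp (\<i> * of_real (2 * pi * x))"
  by (simp add: e_fun_def mult_ac)

lemma norm_e_fun [simp]: "norm (e_fun x) = 1"
  by (simp add: e_fun_altdef)

lemma e_fun_diff: "e_fun (x - y) = e_fun x * cnj (e_fun y)"
  by (simp add: e_fun_altdef exp_cnj ring_distribs flip: exp_add exp_diff)

lemma continuous_on_e_fun [continuous_intros]: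
  "continuous_on S f \<Longrightarrow> continuous_on S (\<lambda>x. e_fun (f x))"
  unfolding e_fun_def by (intro continuous_intros)

lemma has_vector_derivative_e_fun:
  assumes "(g has_real_derivative g') (at t within S)"
  shows "((\<lambda>t. e_fun (g t)) has_vector_derivative (2 * pi * \<i> * g' * e_fun (g t))) (at t within S)"
proof -
  have "((\<lambda>t. complex_of_real (g t)) has_vector_derivative of_real g') (at t within S)"
    using assms by (simp add: has_real_derivative_iff_has_vector_derivative has_vector_derivative_of_real)
  then have "((\<lambda>t. 2 * of_real pi * \<i> * complex_of_real (g t)) has_vector_derivative
      2 * of_real pi * \<i> * of_real g') (at t within S)"
    by (rule has_vector_derivative_mult_right)
  from field_vector_diff_chain_within[OF this DERIV_subset[OF DERIV_exp subset_UNIV]]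
  show ?thesis
    by (simp add: e_fun_def o_def)
qed

lemma norm_e_fun_diff_le: "norm (e_fun x - e_fun y) \<le> 2 * pi * \<bar>x - y\<bar>"
proof -
  have "e_fun x - e_fun y = e_fun y * (e_fun (x - y) - 1)"
    by (simp add: e_fun_altdef ring_distribs flip: exp_add)
  then have "norm (e_fun x - e_fun y) = 2 * \<bar>sin (2 * pi * (x - y) / 2)\<bar>"
    by (simp only: norm_mult norm_e_fun e_fun_altdef[of "x - y"] dist_exp_i_1)
  also have "\<dots> \<le> 2 * \<bar>2 * pi * (x - y) / 2\<bar>"
    using abs_sin_x_le_abs_x by (intro mult_left_mono) auto
  finally show ?thesis
    by (simp add: abs_mult)
qed

text \<open>Integrating by parts with \<open>1 / g'\<close>, the remaining integral is dominated by that of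
  \<open>- (1 / g')'\<close>, which telescopes.\<close>

lemma van_der_Corput_first_derivative:
  fixes g g' g'' :: "real \<Rightarrow> real"
  assumes "a \<le> b" "0 < c"
    and g: "\<And>t. t \<in> {a..b} \<Longrightarrow> (g has_real_derivative g' t) (at t within {a..b})"
    and g': "\<And>t. t \<in> {a..b} \<Longrightarrow> (g' has_real_derivative g'' t) (at t within {a..b})"
    and lower: "\<And>t. t \<in> {a..b} \<Longrightarrow> c \<le> g' t"
    and convex: "\<And>t. t \<in> {a..b} \<Longrightarrow> 0 \<le> g'' t"
  shows "norm (integral {a..b} (\<lambda>t. e_fun (g t))) \<le> 1 / (pi * c)"
proof -
  define h where "h t = inverse (g' t)" for t
  define h' where "h' t = - (g'' t / (g' t)\<^sup>2)" for t
  have pos: "g' t > 0" if "t \<in> {a..b}" for t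
    using lower[OF that] \<open>0 < c\<close> by linarith
  have h: "(h has_real_derivative h' t) (at t within {a..b})" if "t \<in> {a..b}" for t
    unfolding h_def h'_def using pos[OF that]
    by (auto intro!: derivative_eq_intros g'[OF that] simp: field_simps power2_eq_square)
  have "((\<lambda>t. h t *\<^sub>R e_fun (g t)) has_vector_derivative
      2 * pi * \<i> * e_fun (g t) + h' t *\<^sub>R e_fun (g t)) (at t within {a..b})"
    if "t \<in> {a..b}" for t
    using has_vector_derivative_scaleR[OF h[OF that] has_vector_derivative_e_fun[OF g[OF that]]]
      pos[OF that] by (simp add: h_def scaleR_conv_of_real field_simps)
  then have total: "((\<lambda>t. 2 * pi * \<i> * e_fun (g t) + h' t *\<^sub>R e_fun (g t)) has_integral
      h b *\<^sub>R e_fun (g b) - h a *\<^sub>R e_fun (g a)) {a..b}"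
    by (intro fundamental_theorem_of_calculus \<open>a \<le> b\<close>)
  have cont: "continuous_on {a..b} g"
    using g by (rule DERIV_continuous_on)
  then have int_e: "(\<lambda>t. e_fun (g t)) integrable_on {a..b}"
    by (intro integrable_continuous_interval continuous_intros)
  then have main: "((\<lambda>t. 2 * pi * \<i> * e_fun (g t)) has_integral
      2 * pi * \<i> * integral {a..b} (\<lambda>t. e_fun (g t))) {a..b}"
    by (intro has_integral_mult_right integrable_integral)
  have rest: "((\<lambda>t. h' t *\<^sub>R e_fun (g t)) has_integral
      (h b *\<^sub>R e_fun (g b) - h a *\<^sub>R e_fun (g a)
        - 2 * pi * \<i> * integral {a..b} (\<lambda>t. e_fun (g t)))) {a..b}"
    using has_integral_diff[OF total main] by simp
  have "((\<lambda>t. - h' t) has_integral - h b - - h a) {a..b}"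
    using h by (intro fundamental_theorem_of_calculus \<open>a \<le> b\<close>)
      (auto intro!: derivative_intros simp flip: has_real_derivative_iff_has_vector_derivative)
  moreover have "norm (h' t *\<^sub>R e_fun (g t)) \<le> - h' t" if "t \<in> {a..b}" for t
    using convex[OF that] by (simp add: h'_def abs_mult)
  ultimately have rest_le: "norm (integral {a..b} (\<lambda>t. h' t *\<^sub>R e_fun (g t))) \<le> h a - h b"
    using integral_norm_bound_integral[of "\<lambda>t. h' t *\<^sub>R e_fun (g t)" "{a..b}" "\<lambda>t. - h' t"] rest
    by (metis (no_types, lifting) add.commute diff_minus_eq_add has_integral_integrable integral_unique
        uminus_add_conv_diff)
  have "2 * pi * norm (integral {a..b} (\<lambda>t. e_fun (g t))) =
      norm (h b *\<^sub>R e_fun (g b) - h a *\<^sub>R e_fun (g a) - integral {a..b} (\<lambda>t. h' t *\<^sub>R e_fun (g t)))"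
    using integral_unique[OF rest] by (simp add: norm_mult)
  also have "\<dots> \<le> norm (h b *\<^sub>R e_fun (g b)) + norm (h a *\<^sub>R e_fun (g a))
      + norm (integral {a..b} (\<lambda>t. h' t *\<^sub>R e_fun (g t)))"
    by (intro order_trans[OF norm_triangle_ineq4] add_mono norm_triangle_ineq4 order_refl)
  \<comment> \<open>The boundary terms contribute at most \<open>h a + h b\<close> and the remaining
    integral at most \<open>h a - h b\<close>, so \<open>h b\<close> cancels and only the lower
    bound on \<open>g'\<close> at the left endpoint enters.\<close>
  finally have "2 * pi * norm (integral {a..b} (\<lambda>t. e_fun (g t))) \<le> 2 * h a"
    using rest_le pos[of a] pos[of b] \<open>a \<le> b\<close> by (simp add: h_def)
  also have "\<dots> \<le> 2 * (1 / c)"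
    using lower[of a] \<open>0 < c\<close> \<open>a \<le> b\<close> by (simp add: h_def field_simps)
  finally show ?thesis
    using \<open>0 < c\<close> by (simp add: field_simps)
qed

section \<open>Mean squares of blocks along the moment curve\<close>

definition moment_phase :: "nat \<Rightarrow> nat \<Rightarrow> real \<Rightarrow> real" where
  "moment_phase d n t = (\<Sum>j = 1..d. t ^ j * real n ^ j)"

definition moment_sum :: "nat \<Rightarrow> (nat \<Rightarrow> complex) \<Rightarrow> nat set \<Rightarrow> real \<Rightarrow> complex" where
  "moment_sum d a I t = (\<Sum>n\<in>I. a n * e_fun (moment_phase d n t))"

lemma continuous_on_moment_phase [continuous_intros]: "continuous_on S (moment_phase d n)"
  unfolding moment_phase_def by (intro continuous_intros)

lemma continuous_on_moment_sum [continuous_intros]: "continuous_on S (moment_sum d a I)"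
  unfolding moment_sum_def by (intro continuous_intros continuous_on_moment_phase)

text \<open>The phase difference is a polynomial in \<open>t\<close> with nonnegative coefficients
  \<open>n ^ j - m ^ j\<close>. On \<open>[0, 1]\<close> its second derivative is therefore
  nonnegative, and its first derivative is at least the contribution \<open>n - m\<close> of the
  linear term.\<close>

lemma norm_integral_moment_phase_diff:
  assumes "m < n" "1 \<le> d"
  shows "norm (integral {0..1} (\<lambda>t. e_fun (moment_phase d n t - moment_phase d m t)))
           \<le> 1 / (real n - real m)"
proof -
  define c where "c j = real n ^ j - real m ^ j" for j
  have c: "c j \<ge> 0" for j
    using assms by (simp add: c_def power_mono)
  define g' where "g' t = (\<Sum>j = 1..d. c j * (real j * t ^ (j - 1)))" for t
  define g'' where "g'' t = (\<Sum>j = 1..d. c j * (real j * (real (j - 1) * t ^ (j - 1 - 1))))" for t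
  have "((\<lambda>t. moment_phase d n t - moment_phase d m t) has_real_derivative g' t) (at t within {0..1})"
    for t
  proof -
    have "((\<lambda>t. \<Sum>j = 1..d. c j * t ^ j) has_real_derivative g' t) (at t within {0..1})"
      unfolding g'_def by (auto intro!: derivative_eq_intros sum.cong)
    moreover have "(\<lambda>t. \<Sum>j = 1..d. c j * t ^ j) = (\<lambda>t. moment_phase d n t - moment_phase d m t)"
      by (simp add: moment_phase_def c_def fun_eq_iff algebra_simps sum_subtractf)
    ultimately show ?thesis by simp
  qed
  moreover have "(g' has_real_derivative g'' t) (at t within {0..1})" for t
    unfolding g'_def g''_def by (auto intro!: derivative_eq_intros sum.cong)
  moreover have "real n - real m \<le> g' t" if "t \<in> {0..1}" for t
  proof -
    have "c 1 * (real 1 * t ^ (1 - 1)) \<le> g' t"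
      unfolding g'_def using that assms c by (intro member_le_sum) auto
    then show ?thesis by (simp add: c_def)
  qed
  moreover have "0 \<le> g'' t" if "t \<in> {0..1}" for t
    unfolding g''_def using that c by (intro sum_nonneg mult_nonneg_nonneg) auto
  ultimately have "norm (integral {0..1} (\<lambda>t. e_fun (moment_phase d n t - moment_phase d m t)))
      \<le> 1 / (pi * (real n - real m))"
    using assms by (intro van_der_Corput_first_derivative[where g' = g' and g'' = g'']) auto
  also have "\<dots> \<le> 1 / (1 * (real n - real m))"
    using assms pi_gt3 by (intro divide_left_mono mult_right_mono) auto
  finally show ?thesis by simp
qed

text \<open>Exchanging \<open>m\<close> and \<open>n\<close> conjugates the integrand, which leaves
  the modulus of the integral unchanged.\<close>

lemma norm_integral_moment_phase_diff':
  assumes "m \<noteq> n" "1 \<le> d"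
  shows "norm (integral {0..1} (\<lambda>t. e_fun (moment_phase d n t - moment_phase d m t)))
           \<le> 1 / \<bar>real n - real m\<bar>"
proof (cases "m < n")
  case True
  then show ?thesis using norm_integral_moment_phase_diff[OF True assms(2)] by simp
next
  case False
  have cnj: "e_fun (moment_phase d n t - moment_phase d m t) =
      cnj (e_fun (moment_phase d m t - moment_phase d n t))" for t
    by (simp add: e_fun_diff mult.commute)
  show ?thesis
    unfolding cnj integral_cnj[symmetric]
    using norm_integral_moment_phase_diff[of n m d] False assms by simp
qed

text \<open>Doubling the range adds \<open>2 ^ j\<close> terms, each at most
  \<open>1 / 2 ^ j\<close>. Growth linear in \<open>j\<close> is good enough, as factors polynomial
  in the scale are later absorbed into \<open>x powr \<epsilon>\<close>.\<close>

lemma harm_two_power_le: "harm (2 ^ j) \<le> real j + 1"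
proof (induction j)
  case 0
  then show ?case by (simp add: harm_expand)
next
  case (Suc j)
  have "harm (2 ^ Suc j) = (harm (2 ^ j) + (\<Sum>k\<in>{2^j<..2 * 2^j}. inverse (real k)) :: real)"
    unfolding harm_def by (subst sum.union_disjoint[symmetric]) (auto intro!: sum.cong)
  also have "(\<Sum>k\<in>{2^j<..2 * 2^j}. inverse (real k)) \<le> of_nat (card {(2::nat)^j<..2 * 2^j}) * inverse (2 ^ j)"
  proof (intro sum_bounded_above)
    fix k assume "k \<in> {(2::nat)^j<..2 * 2^j}"
    then have "real (2 ^ j) \<le> real k"
      by (intro of_nat_mono) auto
    then show "inverse (real k) \<le> inverse (2 ^ j)"
      by (intro le_imp_inverse_le) auto
  qed
  finally show ?case using Suc by simp
qed

text \<open>On either side of \<open>n\<close> the distances are consecutive integers starting at 1,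
  so each side contributes an initial segment of the harmonic sum.\<close>

lemma sum_inverse_distance_le:
  assumes "n \<in> {p<..p + L}"
  shows "(\<Sum>m\<in>{p<..p + L} - {n}. 1 / \<bar>real n - real m\<bar>) \<le> 2 * harm L"
proof -
  have "(\<Sum>m\<in>{p<..<n}. 1 / \<bar>real n - real m\<bar>) = (\<Sum>k\<in>{1..<n - p}. inverse (real k))"
    using assms by (intro sum.reindex_bij_witness[of _ "\<lambda>k. n - k" "\<lambda>m. n - m"])
      (auto simp: of_nat_diff field_simps)
  also have "\<dots> \<le> harm L"
    unfolding harm_def using assms by (intro sum_mono2) auto
  finally have left: "(\<Sum>m\<in>{p<..<n}. 1 / \<bar>real n - real m\<bar>) \<le> harm L" .
  have "(\<Sum>m\<in>{n<..p + L}. 1 / \<bar>real n - real m\<bar>) = (\<Sum>k\<in>{1..p + L - n}. inverse (real k))"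
    using assms by (intro sum.reindex_bij_witness[of _ "\<lambda>k. n + k" "\<lambda>m. m - n"])
      (auto simp: of_nat_diff field_simps)
  also have "\<dots> \<le> harm L"
    unfolding harm_def using assms by (intro sum_mono2) auto
  finally have "(\<Sum>m\<in>{n<..p + L}. 1 / \<bar>real n - real m\<bar>) \<le> harm L" .
  moreover have "{p<..p + L} - {n} = {p<..<n} \<union> {n<..p + L}"
    using assms by auto
  moreover have "(\<Sum>m\<in>{p<..<n} \<union> {n<..p + L}. 1 / \<bar>real n - real m\<bar>) =
      (\<Sum>m\<in>{p<..<n}. 1 / \<bar>real n - real m\<bar>) + (\<Sum>m\<in>{n<..p + L}. 1 / \<bar>real n - real m\<bar>)"
    by (intro sum.union_disjoint) auto
  ultimately show ?thesis
    using left by simp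
qed

text \<open>After expanding the square, each of the \<open>L\<close> rows costs 1 for its diagonal
  entry plus the sum of the off-diagonal bounds \<open>1 / |n - m|\<close>.\<close>

lemma mean_square_moment_sum:
  assumes "1 \<le> d" and a: "\<And>n. n \<in> {p<..p + L} \<Longrightarrow> norm (a n) \<le> A"
  shows "integral {0..1} (\<lambda>t. (norm (moment_sum d a {p<..p + L} t))\<^sup>2)
           \<le> A\<^sup>2 * real L * (1 + 2 * harm L)"
proof -
  let ?I = "{p<..p + L}"
  let ?e = "\<lambda>n m t. e_fun (moment_phase d n t - moment_phase d m t)"
  \<comment> \<open>\<open>?w\<close> majorizes the modulus of the integral of \<open>?e\<close>. On
    the diagonal the integrand is constantly 1, where the default value \<open>1 / 0 = 0\<close>
    would be wrong.\<close>
  let ?w = "\<lambda>n m. if n = m then 1 else 1 / \<bar>real n - real m\<bar>"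
  have expand: "complex_of_real ((norm (moment_sum d a ?I t))\<^sup>2) =
      (\<Sum>n\<in>?I. \<Sum>m\<in>?I. a n * cnj (a m) * ?e n m t)" for t
    unfolding complex_norm_square moment_sum_def
    by (simp add: e_fun_diff sum_product mult_ac)
  have int: "?e n m integrable_on {0..1}" for n m
    by (intro integrable_continuous_interval continuous_intros continuous_on_moment_phase)
  have "(\<lambda>t. (norm (moment_sum d a ?I t))\<^sup>2) integrable_on {0..1}"
    by (intro integrable_continuous_interval continuous_intros continuous_on_moment_sum)
  \<comment> \<open>The expanded square is a sum of complex terms, so the real integral is first
    moved into the complex numbers.\<close>
  then have "complex_of_real (integral {0..1} (\<lambda>t. (norm (moment_sum d a ?I t))\<^sup>2)) =
      integral {0..1} (\<lambda>t. complex_of_real ((norm (moment_sum d a ?I t))\<^sup>2))"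
    by (intro integral_unique[symmetric] has_integral_of_real integrable_integral)
  also have "\<dots> = (\<Sum>n\<in>?I. \<Sum>m\<in>?I. a n * cnj (a m) * integral {0..1} (?e n m))"
    unfolding expand by (simp add: integral_sum int integrable_sum integrable_on_mult_right)
  finally have eq: "complex_of_real (integral {0..1} (\<lambda>t. (norm (moment_sum d a ?I t))\<^sup>2)) = \<dots>" .
  have "\<bar>integral {0..1} (\<lambda>t. (norm (moment_sum d a ?I t))\<^sup>2)\<bar> =
      norm (\<Sum>n\<in>?I. \<Sum>m\<in>?I. a n * cnj (a m) * integral {0..1} (?e n m))"
    unfolding eq[symmetric] norm_of_real ..
  also have "\<dots> \<le> (\<Sum>n\<in>?I. \<Sum>m\<in>?I. A\<^sup>2 * ?w n m)"
  proof (intro sum_norm_le)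
    fix n m assume nm: "n \<in> ?I" "m \<in> ?I"
    have "norm (a n * cnj (a m)) \<le> A * A"
      unfolding norm_mult complex_mod_cnj using a[OF nm(1)] a[OF nm(2)]
      by (intro mult_mono) (auto intro: order_trans[OF norm_ge_zero])
    moreover have "norm (integral {0..1} (?e n m)) \<le> ?w n m"
      using norm_integral_moment_phase_diff'[of m n d] \<open>1 \<le> d\<close>
      by (cases "n = m") (auto simp: e_fun_def)
    ultimately show "norm (a n * cnj (a m) * integral {0..1} (?e n m)) \<le> A\<^sup>2 * ?w n m"
      unfolding norm_mult[of "a n * cnj (a m)"] power2_eq_square by (intro mult_mono) auto
  qed
  also have "\<dots> \<le> (\<Sum>n\<in>?I. A\<^sup>2 * (1 + 2 * harm L))"
  proof (intro sum_mono)
    fix n assume n: "n \<in> ?I"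
    have "(\<Sum>m\<in>?I. ?w n m) = 1 + (\<Sum>m\<in>?I - {n}. ?w n m)"
      using n by (subst sum.remove[of _ n]) auto
    also have "(\<Sum>m\<in>?I - {n}. ?w n m) = (\<Sum>m\<in>?I - {n}. 1 / \<bar>real n - real m\<bar>)"
      by (intro sum.cong) auto
    finally show "(\<Sum>m\<in>?I. A\<^sup>2 * ?w n m) \<le> A\<^sup>2 * (1 + 2 * harm L)"
      unfolding sum_distrib_left[symmetric] using sum_inverse_distance_le[OF n]
      by (intro mult_left_mono) auto
  qed
  finally show ?thesis
    by (simp add: mult_ac)
qed

section \<open>Lipschitz bounds and large values on a grid\<close>

lemma abs_power_diff_le:
  fixes s t :: real
  assumes "s \<in> {0..1}" "t \<in> {0..1}"
  shows "\<bar>t ^ j - s ^ j\<bar> \<le> real j * \<bar>t - s\<bar>"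
  using norm_power_diff[of t s j] assms by simp

lemma moment_phase_diff_le:
  assumes "s \<in> {0..1}" "t \<in> {0..1}" "1 \<le> N" "n \<le> N"
  shows "\<bar>moment_phase d n t - moment_phase d n s\<bar> \<le> (real d)\<^sup>2 * real N ^ d * \<bar>t - s\<bar>"
proof -
  have "\<bar>moment_phase d n t - moment_phase d n s\<bar> = \<bar>\<Sum>j = 1..d. (t ^ j - s ^ j) * real n ^ j\<bar>"
    by (simp add: moment_phase_def algebra_simps sum_subtractf)
  also have "\<dots> \<le> (\<Sum>j = 1..d. real d * \<bar>t - s\<bar> * real N ^ d)"
  proof (intro order_trans[OF sum_abs] sum_mono)
    fix j assume j: "j \<in> {1..d}"
    have "\<bar>t ^ j - s ^ j\<bar> \<le> real d * \<bar>t - s\<bar>"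
      using j by (intro order_trans[OF abs_power_diff_le] mult_right_mono assms) auto
    moreover have "real n ^ j \<le> real N ^ d"
      using j assms by (intro order_trans[OF power_mono[of "real n" "real N"] power_increasing]) auto
    ultimately show "\<bar>(t ^ j - s ^ j) * real n ^ j\<bar> \<le> real d * \<bar>t - s\<bar> * real N ^ d"
      unfolding abs_mult by (intro mult_mono) auto
  qed
  finally show ?thesis
    by (simp add: power2_eq_square mult_ac)
qed

text \<open>For a block below \<open>N\<close> the cardinality is at most \<open>N\<close>, so this
  Lipschitz constant is of order \<open>A * N ^ (d + 1)\<close>; it decides how fine the grid has to
  be.\<close>

lemma moment_sum_diff_le:
  assumes "s \<in> {0..1}" "t \<in> {0..1}" "1 \<le> N" "I \<subseteq> {..N}"
    and a: "\<And>n. n \<in> I \<Longrightarrow> norm (a n) \<le> A"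
  shows "norm (moment_sum d a I t - moment_sum d a I s)
           \<le> real (card I) * A * (2 * pi * (real d)\<^sup>2 * real N ^ d) * \<bar>t - s\<bar>"
proof -
  have "norm (moment_sum d a I t - moment_sum d a I s) =
      norm (\<Sum>n\<in>I. a n * (e_fun (moment_phase d n t) - e_fun (moment_phase d n s)))"
    by (simp add: moment_sum_def algebra_simps sum_subtractf)
  also have "\<dots> \<le> (\<Sum>n\<in>I. A * (2 * pi * ((real d)\<^sup>2 * real N ^ d * \<bar>t - s\<bar>)))"
  proof (intro sum_norm_le)
    fix n assume n: "n \<in> I"
    have "norm (e_fun (moment_phase d n t) - e_fun (moment_phase d n s))
        \<le> 2 * pi * ((real d)\<^sup>2 * real N ^ d * \<bar>t - s\<bar>)"
      using n assms
      by (intro order_trans[OF norm_e_fun_diff_le] mult_left_mono moment_phase_diff_le) auto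
    then show "norm (a n * (e_fun (moment_phase d n t) - e_fun (moment_phase d n s)))
        \<le> A * (2 * pi * ((real d)\<^sup>2 * real N ^ d * \<bar>t - s\<bar>))"
      unfolding norm_mult using a[OF n] by (intro mult_mono) (auto intro: order_trans[OF norm_ge_zero])
  qed
  finally show ?thesis
    by (simp add: mult_ac)
qed

text \<open>If \<open>|f|\<close> reaches \<open>c\<close> somewhere on a grid interval, then the Lipschitz bound keeps it above
  \<open>c / 2\<close> on the whole interval, which then contributes at least \<open>c\<^sup>2 / (4 L)\<close> to the integral.\<close>

lemma card_large_intervals_le:
  fixes f :: "real \<Rightarrow> complex" and L :: nat
  assumes cont: "continuous_on {0..1} f" and "0 < L" "0 < c"
    and lip: "\<And>s t. s \<in> {0..1} \<Longrightarrow> t \<in> {0..1} \<Longrightarrow> norm (f t - f s) \<le> D * \<bar>t - s\<bar>"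
    and D: "0 \<le> D" "2 * D \<le> c * real L"
  shows "real (card {l. l < L \<and> (\<exists>t\<in>{real l / real L..real (Suc l) / real L}. c \<le> norm (f t))}) * c\<^sup>2
           \<le> 4 * real L * integral {0..1} (\<lambda>t. (norm (f t))\<^sup>2)"
proof -
  let ?J = "\<lambda>l. {real l / real L..real (Suc l) / real L}"
  let ?F = "\<lambda>t. (norm (f t))\<^sup>2"
  define B where "B = {l. l < L \<and> (\<exists>t\<in>?J l. c \<le> norm (f t))}"
  \<comment> \<open>Extending the lower bound by 0 to the intervals outside \<open>B\<close> lets
    the sum run over the whole grid.\<close>
  define b where "b l = (if l \<in> B then c\<^sup>2 / (4 * real L) else 0)" for l
  have sub: "{0..real m / real L} \<subseteq> {0..1}" if "m \<le> L" for m
    using that \<open>0 < L\<close> by (auto simp: field_simps)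
  have Jsub: "?J l \<subseteq> {0..1}" if "l < L" for l
    using that \<open>0 < L\<close> sub[of "Suc l"] by (auto intro: order_trans[rotated])
  have int: "?F integrable_on S" if "S \<subseteq> {0..1}" "S = {u..v}" for S u v
    unfolding that(2) using that
    by (intro integrable_continuous_interval continuous_intros continuous_on_subset[OF cont]) auto
  have low: "b l \<le> integral (?J l) ?F" if "l < L" for l
  proof (cases "l \<in> B")
    case True
    then obtain u where u: "u \<in> ?J l" "c \<le> norm (f u)"
      by (auto simp: B_def)
    have "(c / 2)\<^sup>2 \<le> ?F t" if t: "t \<in> ?J l" for t
    proof -
      have "\<bar>t - u\<bar> \<le> real (Suc l) / real L - real l / real L"
        using t u by auto
      also have "\<dots> = 1 / real L"
        by (simp add: diff_divide_distrib[symmetric])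
      finally have "D * \<bar>t - u\<bar> \<le> D * (1 / real L)"
        using D by (intro mult_left_mono)
      also have "\<dots> \<le> c / 2"
        using D \<open>0 < L\<close> by (simp add: field_simps)
      finally have "norm (f t - f u) \<le> c / 2"
        using lip[of u t] t u Jsub[OF \<open>l < L\<close>] by fastforce
      then have "c / 2 \<le> norm (f t)"
        using u(2) norm_triangle_sub[of "f u" "f t"] by (simp add: norm_minus_commute)
      then show ?thesis
        using \<open>0 < c\<close> by (intro power_mono) auto
    qed
    then have "integral (?J l) (\<lambda>_. (c / 2)\<^sup>2) \<le> integral (?J l) ?F"
      by (intro integral_le int[OF Jsub[OF \<open>l < L\<close>] refl]) auto
    then show ?thesis
      using True \<open>0 < L\<close> by (simp add: b_def power2_eq_square divide_right_mono field_simps)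
  next
    case False
    moreover have "0 \<le> integral (?J l) ?F"
      by (intro integral_nonneg int[OF Jsub[OF \<open>l < L\<close>] refl]) simp
    ultimately show ?thesis
      by (simp add: b_def)
  qed
  \<comment> \<open>Neighbouring intervals share an endpoint; adding the integrals one interval at a
    time avoids any appeal to disjointness.\<close>
  have "(\<Sum>l<m. b l) \<le> integral {0..real m / real L} ?F" if "m \<le> L" for m
    using that
  proof (induction m)
    case (Suc m)
    have "integral {0..real m / real L} ?F + integral (?J m) ?F = integral {0..real (Suc m) / real L} ?F"
      by (rule Henstock_Kurzweil_Integration.integral_combine[OF _ _ int[OF sub[OF Suc.prems] refl]])
        (auto simp: divide_right_mono)
    then show ?case
      using Suc low[of m] by simp
  qed simp
  from this[of L] have "(\<Sum>l<L. b l) \<le> integral {0..1} ?F"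
    using \<open>0 < L\<close> by simp
  moreover have "(\<Sum>l<L. b l) = (\<Sum>l\<in>B. c\<^sup>2 / (4 * real L))"
    unfolding b_def B_def by (intro sum.mono_neutral_cong_right) auto
  ultimately have "real (card B) * c\<^sup>2 / (4 * real L) \<le> integral {0..1} ?F"
    by simp
  then show ?thesis
    using \<open>0 < L\<close> by (simp add: B_def field_simps)
qed

section \<open>Dyadic splitting of partial sums\<close>

text \<open>\<open>M div 2 ^ j * 2 ^ j\<close> clears the lowest \<open>j\<close> binary digits of
  \<open>M\<close>. Clearing one more digit removes a block of length \<open>2 ^ j\<close> if the
  digit is 1 and nothing if it is 0; after \<open>K\<close> steps only the empty sum is
  left.\<close>

lemma norm_sum_le_dyadic_blocks:
  fixes c :: "nat \<Rightarrow> 'a::real_normed_vector"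
  assumes "M < 2 ^ K"
    and block: "\<And>j p. j < K \<Longrightarrow> p < 2 ^ (K - j) \<Longrightarrow> norm (\<Sum>n\<in>{p * 2 ^ j<..p * 2 ^ j + 2 ^ j}. c n) \<le> b"
  shows "norm (\<Sum>n\<in>{0<..M}. c n) \<le> real K * b"
proof -
  define S where "S x = (\<Sum>n\<in>{0<..x}. c n)" for x :: nat
  have "norm (S M - S (M div 2 ^ j * 2 ^ j)) \<le> real j * b" if "j \<le> K" for j
    using that
  proof (induction j)
    case (Suc j)
    define q where "q = M div 2 ^ j"
    have div: "M div 2 ^ Suc j = q div 2"
      by (simp only: q_def power_Suc2 div_mult2_eq)
    have "(2::nat) ^ K = 2 ^ (K - j) * 2 ^ j"
      using Suc.prems by (simp flip: power_add)
    then have q: "q < 2 ^ (K - j)"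
      using \<open>M < 2 ^ K\<close> by (simp add: q_def less_mult_imp_div_less)
    have "norm (S (q * 2 ^ j) - S (q div 2 * 2 ^ Suc j)) \<le> b"
    proof (cases "even q")
      case True
      then obtain r where "q = 2 * r"
        by (auto elim: evenE)
      \<comment> \<open>Nothing is removed in this case, so \<open>b\<close> has to be nonnegative,
        which the bound on the first block shows.\<close>
      moreover have "0 \<le> b"
        using block[of j 0] Suc.prems by (intro order_trans[OF norm_ge_zero]) auto
      ultimately show ?thesis
        by (simp add: mult_ac)
    next
      case False
      then obtain r where r: "q = Suc (2 * r)"
        by (auto elim: oddE)
      have "S (q * 2 ^ j) = S (2 * r * 2 ^ j) + (\<Sum>n\<in>{2 * r * 2 ^ j<..2 * r * 2 ^ j + 2 ^ j}. c n)"
        unfolding S_def by (subst sum.union_disjoint[symmetric]) (auto intro!: sum.cong simp: r)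
      then show ?thesis
        using block[of j "2 * r"] Suc.prems q by (simp add: r mult_ac)
    qed
    moreover have "norm (S M - S (q * 2 ^ j)) \<le> real j * b"
      using Suc by (simp add: q_def)
    ultimately show ?case
      unfolding div using norm_triangle_ineq[of "S M - S (q * 2 ^ j)" "S (q * 2 ^ j) - S (q div 2 * 2 ^ Suc j)"]
      by (simp add: algebra_simps)
  qed simp
  from this[of K] show ?thesis
    using \<open>M < 2 ^ K\<close> by (simp add: S_def)
qed

section \<open>Hausdorff measure of limsup sets\<close>

text \<open>This is the convergence half of the Borel-Cantelli argument: for every \<open>m\<close>
  the sets at scales \<open>k \<ge> m\<close> cover \<open>A\<close>, and the tail of a convergent
  series makes that cover arbitrarily cheap.\<close>

lemma hausdorff_measure_limsup_eq_0:
  fixes A :: "'a::metric_space set" and V :: "nat \<Rightarrow> nat \<Rightarrow> 'a set"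
  assumes "0 < s"
    and cover: "\<And>m. A \<subseteq> (\<Union>k\<in>{m..}. \<Union>l\<in>B k. V k l)"
    and finite: "\<And>k. finite (B k)"
    and bounded: "\<And>k l. bounded (V k l)"
    and diam: "\<And>k l. diameter (V k l) \<le> \<delta> k"
    and \<delta>: "\<delta> \<longlonglongrightarrow> 0"
    and sum: "summable (\<lambda>k. real (card (B k)) * \<delta> k powr s)"
  shows "hausdorff_measure s A = 0"
proof -
  have le: "hausdorff_premeasure s r A \<le> 0 + ennreal e" if "0 < r" "0 < e" for r e
  proof -
    have "eventually (\<lambda>k. \<delta> k < r) sequentially"
      using \<delta> \<open>0 < r\<close> by (rule order_tendstoD)
    moreover have "eventually (\<lambda>m. (\<Sum>k. real (card (B (k + m))) * \<delta> (k + m) powr s) < e) sequentially"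
      using suminf_exist_split2[OF sum] \<open>0 < e\<close> by (rule order_tendstoD)
    \<comment> \<open>\<open>m\<close> is far enough out for the sets to have diameter below
      \<open>r\<close> and for the total cost to be below \<open>e\<close>.\<close>
    ultimately obtain m where m: "\<And>k. m \<le> k \<Longrightarrow> \<delta> k < r"
        "(\<Sum>k. real (card (B (k + m))) * \<delta> (k + m) powr s) < e"
      by (metis (mono_tags, lifting) eventually_conj eventually_sequentially order_refl)
    \<comment> \<open>\<open>hausdorff_premeasure\<close> takes covers by a single sequence, so the
      pairs of scale and index are enumerated by \<open>prod_decode\<close>. Indices outside
      \<open>B (k + m)\<close> give empty sets, whose \<open>diam_power\<close> is 0.\<close>
    define W where "W = (\<lambda>(k, l). if l \<in> B (k + m) then V (k + m) l else {})"
    have "A \<subseteq> (\<Union>i. W (prod_decode i))"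
    proof
      fix x assume "x \<in> A"
      then obtain k l where "m \<le> k" "l \<in> B k" "x \<in> V k l"
        using cover[of m] by blast
      then have "x \<in> W (prod_decode (prod_encode (k - m, l)))"
        by (simp add: W_def)
      then show "x \<in> (\<Union>i. W (prod_decode i))"
        by blast
    qed
    moreover have "bounded (W y)" "diameter (W y) \<le> r" for y
      using bounded diam m(1) \<open>0 < r\<close>
      by (auto simp: W_def split: prod.split intro!: order_trans[OF diam] less_imp_le[OF m(1)])
    ultimately have "hausdorff_premeasure s r A \<le> (\<Sum>i. diam_power s (W (prod_decode i)))"
      unfolding hausdorff_premeasure_def by (intro INF_lower) auto
    also have "\<dots> = (\<Sum>k. \<Sum>l. diam_power s (W (k, l)))"
      by (intro suminf_ennreal_2dimen) simp
    also have "\<dots> \<le> (\<Sum>k. ennreal (real (card (B (k + m))) * \<delta> (k + m) powr s))"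
    proof (intro suminf_le allI)
      fix k
      have "diam_power s (W (k, l)) = 0" if "l \<notin> B (k + m)" for l
        using that by (simp add: W_def diam_power_def)
      then have "(\<Sum>l. diam_power s (W (k, l))) = (\<Sum>l\<in>B (k + m). diam_power s (W (k, l)))"
        by (intro suminf_finite finite) auto
      also have "\<dots> \<le> (\<Sum>l\<in>B (k + m). ennreal (\<delta> (k + m) powr s))"
        using \<open>0 < s\<close> diam bounded
        by (intro sum_mono)
          (auto simp: W_def diam_power_def intro!: ennreal_leI powr_mono2 diameter_ge_0)
      also have "\<dots> = ennreal (real (card (B (k + m))) * \<delta> (k + m) powr s)"
        by (simp add: ennreal_mult ennreal_of_nat_eq_real_of_nat)
      finally show "(\<Sum>l. diam_power s (W (k, l))) \<le> ennreal (real (card (B (k + m))) * \<delta> (k + m) powr s)" .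
    qed auto
    also have "\<dots> = ennreal (\<Sum>k. real (card (B (k + m))) * \<delta> (k + m) powr s)"
      using summable_ignore_initial_segment[OF sum, of m] by (intro suminf_ennreal2) auto
    also have "\<dots> \<le> ennreal e"
      using m(2) by (intro ennreal_leI) simp
    finally show ?thesis by simp
  qed
  have "hausdorff_premeasure s r A \<le> 0" if "0 < r" for r
  proof (rule ennreal_le_epsilon)
    fix e :: real assume "0 < e"
    with that show "hausdorff_premeasure s r A \<le> 0 + ennreal e"
      by (rule le)
  qed
  then show ?thesis
    by (simp add: hausdorff_measure_def)
qed

section \<open>Coordinates on the moment curve\<close>

lemma coord_pos_strict_mono: "i < j \<Longrightarrow> coord_pos i < coord_pos j"
  unfolding coord_pos_def by (intro psubset_card_mono psubsetI) (auto dest!: equalityD2)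

text \<open>Turns sums over the coordinates of a vector into sums over the exponents
  \<open>1, ..., d\<close>. Strict monotonicity gives injectivity, and counting gives
  surjectivity.\<close>

lemma bij_betw_coord_pos:
  "bij_betw (coord_pos :: 'n::{finite,linorder} \<Rightarrow> nat) UNIV {1..CARD('n)}"
proof -
  have inj: "inj (coord_pos :: 'n \<Rightarrow> nat)"
    by (intro linorder_injI) (metis coord_pos_strict_mono nat_neq_iff)
  moreover have "range (coord_pos :: 'n \<Rightarrow> nat) \<subseteq> {1..CARD('n)}"
    by (auto simp: coord_pos_def Suc_le_eq card_gt_0_iff intro!: card_mono)
  moreover have "card (range (coord_pos :: 'n \<Rightarrow> nat)) = card {1..CARD('n)}"
    using inj by (simp add: card_image)
  ultimately show ?thesis
    unfolding bij_betw_def by (metis card_subset_eq finite_atLeastAtMost)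
qed

lemma coord_pos_le: "coord_pos (i :: 'n::{finite,linorder}) \<le> CARD('n)"
  unfolding coord_pos_def by (intro card_mono) auto

definition moment_point :: "real \<Rightarrow> real ^ ('n::{finite,linorder})" where
  "moment_point t = (\<chi> i. t ^ coord_pos i)"

lemma weyl_sum_moment_point:
  "weyl_sum a (moment_point t :: real ^ ('n::{finite,linorder})) M =
     moment_sum CARD('n) a {0<..M} t"
proof -
  have "(\<Sum>i\<in>UNIV. (moment_point t :: (real, 'n) vec) $ i * real n ^ coord_pos i) =
      moment_phase CARD('n) n t" for n
    unfolding moment_phase_def moment_point_def
    by (simp add: sum.reindex_bij_betw[OF bij_betw_coord_pos, of "\<lambda>j. t ^ j * real n ^ j"])
  \<comment> \<open>The half-open form of the range matches that of the dyadic blocks.\<close>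
  moreover have "{1..M} = {0<..M}"
    by auto
  ultimately show ?thesis
    by (simp add: weyl_sum_def moment_sum_def)
qed

lemma norm_moment_point_diff_le:
  assumes "s \<in> {0..1}" "t \<in> {0..1}"
  shows "norm (moment_point t - moment_point s :: real ^ ('n::{finite,linorder}))
           \<le> (real CARD('n))\<^sup>2 * \<bar>t - s\<bar>"
proof -
  have "norm (moment_point t - moment_point s :: (real, 'n) vec)
      \<le> (\<Sum>i\<in>(UNIV :: 'n set). \<bar>t ^ coord_pos i - s ^ coord_pos i\<bar>)"
    by (intro order_trans[OF norm_le_l1_cart]) (simp add: moment_point_def)
  also have "\<dots> \<le> (\<Sum>i\<in>(UNIV :: 'n set). real CARD('n) * \<bar>t - s\<bar>)"
    using coord_pos_le
    by (intro sum_mono order_trans[OF abs_power_diff_le[OF assms]] mult_right_mono) auto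
  finally show ?thesis
    by (simp add: power2_eq_square mult_ac)
qed

section \<open>Large values at one dyadic scale\<close>

lemma exists_grid_interval:
  assumes "t \<in> {0..1}" "0 < L"
  obtains l where "l < L" "t \<in> {real l / real L..real (Suc l) / real L}"
proof (cases "t = 1")
  case True
  \<comment> \<open>The floor used below would give the index \<open>L\<close>, so the right
    endpoint is assigned to the last interval.\<close>
  then show ?thesis
    using that[of "L - 1"] assms by (auto simp: of_nat_diff)
next
  case False
  define l where "l = nat \<lfloor>t * real L\<rfloor>"
  have "real l \<le> t * real L" "t * real L < real l + 1"
    using assms by (auto simp: l_def)
  moreover have "t * real L < real L"
    using False assms by simp
  ultimately have "l < L" "t \<in> {real l / real L..real (Suc l) / real L}"
    using \<open>0 < L\<close> by (linarith, simp add: field_simps)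
  then show ?thesis
    by (rule that)
qed

text \<open>The constant \<open>A\<close> absorbs the finitely many early terms. The restriction to
  \<open>1 \<le> n\<close> matters: \<open>0 powr \<epsilon> = 0\<close>, whereas \<open>a 0\<close>
  is arbitrary.\<close>

lemma subpolynomial_bound:
  assumes "subpolynomial a" "0 < \<epsilon>"
  obtains A where "0 < A" "\<And>n. 1 \<le> n \<Longrightarrow> norm (a n) \<le> A * real n powr \<epsilon>"
proof -
  obtain n0 where n0: "\<And>n. n0 \<le> n \<Longrightarrow> norm (a n) \<le> real n powr \<epsilon>"
    using assms by (auto simp: subpolynomial_def eventually_sequentially)
  define A where "A = 1 + (\<Sum>n<n0. norm (a n))"
  have A: "1 \<le> A"
    by (simp add: A_def sum_nonneg)
  have "norm (a n) \<le> A * real n powr \<epsilon>" if "1 \<le> n" for n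
  proof (cases "n0 \<le> n")
    case True
    then show ?thesis
      using n0[OF True] mult_right_mono[OF A, of "real n powr \<epsilon>"] by simp
  next
    case False
    then have "norm (a n) \<le> (\<Sum>n<n0. norm (a n))"
      by (intro member_le_sum) auto
    also have "\<dots> \<le> A * 1"
      by (simp add: A_def)
    also have "\<dots> \<le> A * real n powr \<epsilon>"
      using A \<open>0 < \<epsilon>\<close> that by (intro mult_left_mono ge_one_powr_ge_zero) auto
    finally show ?thesis .
  qed
  then show ?thesis
    using A that[of A] by simp
qed

text \<open>The lengths \<open>M\<close> fill \<open>[2 ^ (K - 1), 2 ^ K)\<close>. Writing the lower
  end as \<open>2 ^ K \<le> 2 * M\<close> avoids a truncated subtraction and leaves the set empty
  for \<open>K = 0\<close>.\<close>

definition dyadic_large_set :: "nat \<Rightarrow> (nat \<Rightarrow> complex) \<Rightarrow> real \<Rightarrow> nat \<Rightarrow> real set" where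
  "dyadic_large_set d a \<alpha> K = {t \<in> {0..1}. \<exists>M. M < 2 ^ K \<and> 2 ^ K \<le> 2 * M \<and>
     real M powr \<alpha> \<le> norm (moment_sum d a {0<..M} t)}"

text \<open>The three largeness assumptions let a factor \<open>x powr \<epsilon>\<close> absorb, in
  turn, the number of blocks in a partial sum, the constants of the Lipschitz bound, and the
  constants and logarithms of the mean squares summed over all levels. The value of
  \<open>\<beta>\<close> makes the grid fine enough for a large block to stay large across an
  interval.\<close>

lemma dyadic_large_set_cover:
  fixes a :: "nat \<Rightarrow> complex" and K d :: nat
  defines "x \<equiv> (2::real) ^ K"
  assumes "1 \<le> d" "0 < \<epsilon>" "0 < \<alpha>" "\<alpha> < 1" "0 < A"
    and a: "\<And>n. 1 \<le> n \<Longrightarrow> norm (a n) \<le> A * real n powr \<epsilon>"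
    and \<beta>: "\<beta> = real d + 1 - \<alpha> + 3 * \<epsilon>"
    and large1: "2 powr \<alpha> * real K < x powr \<epsilon>"
    and large2: "4 * pi * (real d)\<^sup>2 * A \<le> x powr \<epsilon>"
    and large3: "8 * A\<^sup>2 * (real K * (1 + 2 * real K)) \<le> x powr \<epsilon>"
  obtains L B where "x powr \<beta> \<le> real L" "finite B" "real (card B) \<le> x powr (1 + \<beta> - 2 * \<alpha> + 5 * \<epsilon>)"
    "dyadic_large_set d a \<alpha> K \<subseteq> (\<Union>l\<in>B. {real l / real L..real (Suc l) / real L})"
proof -
  define A' where "A' = A * x powr \<epsilon>"
  \<comment> \<open>The size that some block must reach: \<open>x powr \<alpha>\<close> shared among
    \<open>K\<close> blocks, where lowering the exponent by \<open>\<epsilon>\<close> pays for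
    \<open>K\<close> and for \<open>M\<close> being possibly only \<open>x / 2\<close>.\<close>
  define c where "c = x powr (\<alpha> - \<epsilon>)"
  define L where "L = nat \<lceil>x powr \<beta>\<rceil>"
  define I where "I j p = {p * 2 ^ j<..p * 2 ^ j + 2 ^ j}" for j p :: nat
  define J where "J l = {real l / real L..real (Suc l) / real L}" for l
  define B where "B j p = {l. l < L \<and> (\<exists>t\<in>J l. c \<le> norm (moment_sum d a (I j p) t))}" for j p
  define P where "P = Sigma {..<K} (\<lambda>j. {..<(2::nat) ^ (K - j)})"
  have x: "1 \<le> x"
    by (simp add: x_def)
  have "0 < \<beta>"
    using assms by simp
  \<comment> \<open>This makes rounding up to \<open>L\<close> cost at most a factor 2.\<close>
  then have xb: "1 \<le> x powr \<beta>"
    using x by (simp add: ge_one_powr_ge_zero)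
  then have L: "x powr \<beta> \<le> real L" "real L \<le> 2 * x powr \<beta>" "0 < L"
    unfolding L_def by linarith+
  have "0 < c"
    using x by (simp add: c_def)
  have "0 \<le> A'"
    using \<open>0 < A\<close> by (simp add: A'_def)
  have I_sub: "I j p \<subseteq> {1..2 ^ K}" if "j < K" "p < 2 ^ (K - j)" for j p
  proof -
    have "Suc p * 2 ^ j \<le> 2 ^ (K - j) * 2 ^ j"
      using that by (intro mult_right_mono) auto
    also have "\<dots> = 2 ^ K"
      using that by (simp flip: power_add)
    finally show ?thesis
      by (auto simp: I_def)
  qed
  have aI: "norm (a n) \<le> A'" if n: "n \<in> I j p" "j < K" "p < 2 ^ (K - j)" for n j p
  proof -
    have n': "1 \<le> n" "n \<le> 2 ^ K"
      using I_sub[OF n(2,3)] n(1) by auto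
    then have "real n \<le> x"
      unfolding x_def by (metis of_nat_le_iff of_nat_numeral of_nat_power)
    then have "A * real n powr \<epsilon> \<le> A'"
      unfolding A'_def using assms by (intro mult_left_mono powr_mono2) auto
    then show ?thesis
      using a[OF n'(1)] by linarith
  qed
  have card_B: "real (card (B j p)) * c\<^sup>2 \<le> 4 * real L * (A'\<^sup>2 * 2 ^ j * (1 + 2 * real K))"
    if jp: "j < K" "p < 2 ^ (K - j)" for j p
  proof -
    define D where "D = x * A' * (2 * pi * (real d)\<^sup>2 * x ^ d)"
    have "norm (moment_sum d a (I j p) t - moment_sum d a (I j p) s) \<le> D * \<bar>t - s\<bar>"
      if "s \<in> {0..1}" "t \<in> {0..1}" for s t
    proof -
      have "norm (moment_sum d a (I j p) t - moment_sum d a (I j p) s)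
          \<le> real (card (I j p)) * A' * (2 * pi * (real d)\<^sup>2 * real (2 ^ K) ^ d) * \<bar>t - s\<bar>"
        using I_sub[OF jp] aI jp that by (intro moment_sum_diff_le) auto
      also have "\<dots> = real (card (I j p)) * A' * (2 * pi * (real d)\<^sup>2 * x ^ d) * \<bar>t - s\<bar>"
        by (simp add: x_def)
      also have "real (card (I j p)) \<le> x"
        using jp by (simp add: I_def x_def)
      finally show ?thesis
        using \<open>0 \<le> A'\<close> x by (simp add: D_def mult_right_mono)
    qed
    moreover have "0 \<le> D"
      using \<open>0 \<le> A'\<close> x by (simp add: D_def)
    moreover have "2 * D \<le> c * real L"
    proof -
      \<comment> \<open>Of the \<open>3 * \<epsilon>\<close> in \<open>\<beta>\<close>, one
        \<open>\<epsilon>\<close> pays for the coefficient bound \<open>A'\<close>, one for the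
        constants via \<open>large2\<close>, and one for the lowered threshold
        \<open>c\<close>.\<close>
      have "2 * D = 4 * pi * (real d)\<^sup>2 * A * (x * x ^ d * x powr \<epsilon>)"
        by (simp add: D_def A'_def)
      also have "\<dots> \<le> x powr \<epsilon> * (x * x ^ d * x powr \<epsilon>)"
        using x by (intro mult_right_mono large2) auto
      also have "\<dots> = x powr \<epsilon> * (x powr 1 * x powr real d * x powr \<epsilon>)"
        using x by (simp add: powr_realpow)
      also have "\<dots> = x powr (\<alpha> - \<epsilon> + \<beta>)"
        unfolding \<beta> powr_add[symmetric] by (simp add: algebra_simps)
      also have "\<dots> = c * x powr \<beta>"
        by (simp add: c_def powr_add)
      also have "\<dots> \<le> c * real L"
        using L \<open>0 < c\<close> by (intro mult_left_mono) auto
      finally show ?thesis .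
    qed
    ultimately have "real (card (B j p)) * c\<^sup>2
        \<le> 4 * real L * integral {0..1} (\<lambda>t. (norm (moment_sum d a (I j p) t))\<^sup>2)"
      unfolding B_def J_def using \<open>0 < L\<close> \<open>0 < c\<close>
      by (intro card_large_intervals_le continuous_on_moment_sum)
    also have "integral {0..1} (\<lambda>t. (norm (moment_sum d a (I j p) t))\<^sup>2)
        \<le> A'\<^sup>2 * real (2 ^ j) * (1 + 2 * harm (2 ^ j))"
      using mean_square_moment_sum[OF \<open>1 \<le> d\<close>, of "p * 2 ^ j" "2 ^ j" a A'] aI[of _ j p] jp
      by (simp add: I_def)
    also have "\<dots> \<le> A'\<^sup>2 * real (2 ^ j) * (1 + 2 * real K)"
      using harm_two_power_le[of j] jp by (intro mult_left_mono) auto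
    finally show ?thesis
      by (simp add: mult_left_mono)
  qed
  define B' where "B' = (\<Union>(j, p)\<in>P. B j p)"
  have "finite P"
    by (simp add: P_def)
  have "finite (B j p)" for j p
    by (simp add: B_def)
  then have "finite B'"
    using \<open>finite P\<close> by (auto simp: B'_def)
  have "real (card B') * c\<^sup>2 \<le> (\<Sum>(j, p)\<in>P. real (card (B j p)) * c\<^sup>2)"
  proof -
    have "card B' \<le> (\<Sum>(j, p)\<in>P. card (B j p))"
      unfolding B'_def using card_UN_le[OF \<open>finite P\<close>, of "\<lambda>(j, p). B j p"]
      by (simp add: case_prod_unfold)
    then have "real (card B') \<le> (\<Sum>(j, p)\<in>P. real (card (B j p)))"
      by (simp add: case_prod_unfold flip: of_nat_sum)
    then have "real (card B') * c\<^sup>2 \<le> (\<Sum>(j, p)\<in>P. real (card (B j p))) * c\<^sup>2"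
      by (intro mult_right_mono) auto
    then show ?thesis
      by (simp add: sum_distrib_right case_prod_unfold)
  qed
  also have "\<dots> \<le> (\<Sum>(j, p)\<in>P. 4 * real L * (A'\<^sup>2 * 2 ^ j * (1 + 2 * real K)))"
    using card_B by (intro sum_mono) (auto simp: P_def)
  also have "\<dots> = (\<Sum>j<K. \<Sum>p<(2::nat) ^ (K - j). 4 * real L * (A'\<^sup>2 * 2 ^ j * (1 + 2 * real K)))"
    unfolding P_def by (subst sum.Sigma) auto
  \<comment> \<open>Level \<open>j\<close> has \<open>2 ^ (K - j)\<close> blocks of length
    \<open>2 ^ j\<close>, so every level costs the same multiple of \<open>x\<close>.\<close>
  also have "\<dots> = (\<Sum>j<K. 4 * real L * (A'\<^sup>2 * x * (1 + 2 * real K)))"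
    by (intro sum.cong) (auto simp: x_def simp flip: power_add)
  also have "\<dots> = real L * (4 * A'\<^sup>2 * x * (real K * (1 + 2 * real K)))"
    by simp
  also have "\<dots> \<le> 2 * x powr \<beta> * (4 * A'\<^sup>2 * x * (real K * (1 + 2 * real K)))"
    using L x by (intro mult_right_mono) auto
  also have "\<dots> = 8 * A\<^sup>2 * (real K * (1 + 2 * real K)) * (x powr \<beta> * x * (x powr \<epsilon>)\<^sup>2)"
    by (simp add: A'_def power_mult_distrib)
  also have "\<dots> \<le> x powr \<epsilon> * (x powr \<beta> * x * (x powr \<epsilon>)\<^sup>2)"
    using x by (intro mult_right_mono large3) auto
  \<comment> \<open>The \<open>5 * \<epsilon>\<close> consists of two from the square of
    \<open>A'\<close>, one from \<open>large3\<close>, and two from dividing by the square of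
    \<open>c\<close>.\<close>
  also have "\<dots> = x powr (1 + \<beta> - 2 * \<alpha> + 5 * \<epsilon>) * c\<^sup>2"
  proof -
    have "x powr (1 + \<beta> - 2 * \<alpha> + 5 * \<epsilon>) * c\<^sup>2 = x powr (1 + \<beta> + 3 * \<epsilon>)"
      by (simp add: c_def power2_eq_square add_ac flip: powr_add)
    also have "\<dots> = x powr (\<epsilon> + (\<beta> + 1 + (\<epsilon> + \<epsilon>)))"
      by (simp add: algebra_simps)
    also have "\<dots> = x powr \<epsilon> * (x powr \<beta> * x * (x powr \<epsilon>)\<^sup>2)"
      using x by (simp only: powr_add power2_eq_square) simp
    finally show ?thesis ..
  qed
  finally have "real (card B') \<le> x powr (1 + \<beta> - 2 * \<alpha> + 5 * \<epsilon>)"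
    using \<open>0 < c\<close> by simp
  moreover have "dyadic_large_set d a \<alpha> K \<subseteq> (\<Union>l\<in>B'. J l)"
  proof
    fix t assume "t \<in> dyadic_large_set d a \<alpha> K"
    then obtain M where M: "M < 2 ^ K" "2 ^ K \<le> 2 * M"
        "real M powr \<alpha> \<le> norm (moment_sum d a {0<..M} t)" and t: "t \<in> {0..1}"
      by (auto simp: dyadic_large_set_def)
    have "x / 2 \<le> real M"
      using M(2) of_nat_mono[of "2 ^ K" "2 * M", where 'a = real] by (simp add: x_def)
    then have "(x / 2) powr \<alpha> \<le> norm (moment_sum d a {0<..M} t)"
      using M(3) \<open>0 < \<alpha>\<close> x powr_mono2[of \<alpha> "x / 2" "real M"] by linarith
    moreover have "real K * c < (x / 2) powr \<alpha>"
    proof -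
      have "2 powr \<alpha> * real K * c < x powr \<epsilon> * c"
        using \<open>0 < c\<close> by (intro mult_strict_right_mono large1)
      also have "\<dots> = x powr \<alpha>"
        by (simp add: c_def flip: powr_add)
      finally show ?thesis
        using x by (simp add: powr_divide field_simps)
    qed
    \<comment> \<open>If every block were at most \<open>c\<close>, the dyadic splitting would bound
      the whole sum by \<open>real K * c\<close>; hence some block exceeds \<open>c\<close>.\<close>
    ultimately have "\<not> norm (moment_sum d a {0<..M} t) \<le> real K * c"
      by linarith
    then have "\<not> (\<forall>j p. j < K \<longrightarrow> p < 2 ^ (K - j) \<longrightarrow> norm (moment_sum d a (I j p) t) \<le> c)"
      using norm_sum_le_dyadic_blocks[OF M(1)] unfolding moment_sum_def I_def by blast
    then obtain j p where jp: "j < K" "p < 2 ^ (K - j)" "c \<le> norm (moment_sum d a (I j p) t)"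
      by (auto simp: not_le intro: less_imp_le)
    obtain l where l: "l < L" "t \<in> J l"
      using exists_grid_interval[OF t \<open>0 < L\<close>] unfolding J_def by blast
    then have "l \<in> B j p"
      using jp by (auto simp: B_def)
    then have "l \<in> B'"
      using jp by (auto simp: B'_def P_def)
    then show "t \<in> (\<Union>l\<in>B'. J l)"
      using l by blast
  qed
  ultimately show ?thesis
    using that[of L B'] L \<open>finite B'\<close> unfolding J_def by blast
qed

section \<open>Dimension of the large set on the curve\<close>

text \<open>An infinite set of lengths contains some \<open>M\<close> beyond \<open>2 ^ m\<close>.
  If \<open>2 ^ k \<le> M < 2 ^ (k + 1)\<close>, then \<open>M\<close> belongs to scale
  \<open>k + 1\<close>, which is beyond \<open>m\<close>.\<close>

lemma large_weyl_set_moment_curve_subset: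
  "large_weyl_set a \<alpha> \<inter> (moment_curve :: (real ^ ('n::{finite,linorder})) set)
     \<subseteq> (\<Union>K\<in>{m..}. moment_point ` dyadic_large_set CARD('n) a \<alpha> K)"
proof
  fix x assume x: "x \<in> large_weyl_set a \<alpha> \<inter> (moment_curve :: ((real, 'n) vec) set)"
  then obtain t where t: "t \<in> {0..1}" "x = moment_point t"
    by (auto simp: moment_curve_def moment_point_def)
  have "infinite {N. 1 \<le> N \<and> real N powr \<alpha> \<le> norm (weyl_sum a x N)}"
    using x by (simp add: large_weyl_set_def)
  then obtain M where M: "2 ^ m < M" "real M powr \<alpha> \<le> norm (weyl_sum a x M)"
    unfolding infinite_nat_iff_unbounded by blast
  obtain k where k: "2 ^ k \<le> M" "M < 2 ^ (k + 1)"
    using ex_power_ivl1[of 2 M] M(1) by (auto simp: Suc_le_eq)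
  have "(2::nat) ^ m < 2 ^ (k + 1)"
    using M k by linarith
  then have "m < k + 1"
    using power_less_imp_less_exp[of "2::nat" m "k + 1"] by simp
  moreover have "t \<in> dyadic_large_set CARD('n) a \<alpha> (k + 1)"
    unfolding dyadic_large_set_def using t M(2) k weyl_sum_moment_point[of a t M, where 'n = 'n]
    by (auto intro!: exI[of _ M])
  ultimately show "x \<in> (\<Union>K\<in>{m..}. moment_point ` dyadic_large_set CARD('n) a \<alpha> K)"
    using t by (auto intro!: bexI[of _ "k + 1"])
qed

text \<open>Up to multiples of \<open>\<epsilon>\<close>, the left side of the last assumption is
  the exponent of \<open>2 ^ K\<close> in the cost of covering scale \<open>K\<close>. It is
  negative exactly when \<open>s\<close> exceeds the claimed dimension bound.\<close>

lemma hausdorff_measure_large_weyl_set: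
  fixes a :: "nat \<Rightarrow> complex"
  defines "d \<equiv> CARD('n)"
  assumes "0 < \<alpha>" "\<alpha> < 1" "subpolynomial a" "0 < s"
    and s: "1 - 2 * \<alpha> + (1 - s) * (real d + 1 - \<alpha>) < 0"
  shows "hausdorff_measure s (large_weyl_set a \<alpha> \<inter> (moment_curve :: (real ^ ('n::{finite,linorder})) set)) = 0"
proof -
  \<comment> \<open>The losses add up to \<open>5 * \<epsilon> + 3 * \<epsilon> * (1 - s)\<close>,
    which is below \<open>8 * \<epsilon>\<close>. Dividing by 10 thus keeps
    \<open>2 * \<epsilon>\<close> of decay for a geometric series.\<close>
  define \<epsilon> where "\<epsilon> = - (1 - 2 * \<alpha> + (1 - s) * (real d + 1 - \<alpha>)) / 10"
  define \<beta> where "\<beta> = real d + 1 - \<alpha> + 3 * \<epsilon>"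
  have "0 < \<epsilon>"
    using s by (simp add: \<epsilon>_def)
  have "1 \<le> d"
    by (simp add: d_def Suc_le_eq)
  have "0 < \<beta>"
    using \<open>0 < \<epsilon>\<close> \<open>1 \<le> d\<close> \<open>\<alpha> < 1\<close> by (simp add: \<beta>_def)
  obtain A where A: "0 < A" "\<And>n. 1 \<le> n \<Longrightarrow> norm (a n) \<le> A * real n powr \<epsilon>"
    using subpolynomial_bound[OF \<open>subpolynomial a\<close> \<open>0 < \<epsilon>\<close>] by metis
  have pow: "(2 ^ K) powr y = 2 powr (y * real K)" for K :: nat and y :: real
    by (simp add: powr_powr mult.commute flip: powr_realpow)
  have "\<forall>\<^sub>F K in sequentially. 2 powr \<alpha> * real K < (2 ^ K) powr \<epsilon> \<and>
      4 * pi * (real d)\<^sup>2 * A \<le> (2 ^ K) powr \<epsilon> \<and>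
      8 * A\<^sup>2 * (real K * (1 + 2 * real K)) \<le> (2 ^ K) powr \<epsilon>"
  proof -
    have "\<forall>\<^sub>F K in sequentially. c * real K < 2 powr (\<epsilon> * real K)" if "0 < c" for c
      using that \<open>0 < \<epsilon>\<close> by real_asymp
    moreover have "\<forall>\<^sub>F K in sequentially. c \<le> 2 powr (\<epsilon> * real K)" if "0 < c" for c
      using that \<open>0 < \<epsilon>\<close> by real_asymp
    moreover have "\<forall>\<^sub>F K in sequentially. c * (real K * (1 + 2 * real K)) \<le> 2 powr (\<epsilon> * real K)"
      if "0 < c" for c
      using that \<open>0 < \<epsilon>\<close> by real_asymp
    ultimately show ?thesis
      unfolding pow using A(1) \<open>1 \<le> d\<close> by (intro eventually_conj) auto
  qed
  then obtain K0 where K0: "\<And>K. K0 \<le> K \<Longrightarrow> 2 powr \<alpha> * real K < (2 ^ K) powr \<epsilon> \<and>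
      4 * pi * (real d)\<^sup>2 * A \<le> (2 ^ K) powr \<epsilon> \<and>
      8 * A\<^sup>2 * (real K * (1 + 2 * real K)) \<le> (2 ^ K) powr \<epsilon>"
    by (auto simp: eventually_sequentially)
  \<comment> \<open>Bundling the four properties allows \<open>L\<close> and \<open>B\<close> to be
    chosen together for all scales from \<open>K0\<close> on.\<close>
  define good where "good K L B \<longleftrightarrow> (2 ^ K) powr \<beta> \<le> real L \<and> finite B \<and>
      real (card B) \<le> (2 ^ K) powr (1 + \<beta> - 2 * \<alpha> + 5 * \<epsilon>) \<and>
      dyadic_large_set d a \<alpha> K \<subseteq> (\<Union>l\<in>B. {real l / real L..real (Suc l) / real L})"
    for K L :: nat and B :: "nat set"
  have "\<exists>L B. good K L B" if "K0 \<le> K" for K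
  proof -
    have "2 powr \<alpha> * real K < (2 ^ K) powr \<epsilon>" "4 * pi * (real d)\<^sup>2 * A \<le> (2 ^ K) powr \<epsilon>"
        "8 * A\<^sup>2 * (real K * (1 + 2 * real K)) \<le> (2 ^ K) powr \<epsilon>"
      using K0[OF that] by auto
    note cover = dyadic_large_set_cover[OF \<open>1 \<le> d\<close> \<open>0 < \<epsilon>\<close> \<open>0 < \<alpha>\<close> \<open>\<alpha> < 1\<close> A \<beta>_def this]
    show ?thesis
    proof (rule cover)
      fix L B
      assume "(2 ^ K) powr \<beta> \<le> real L" "finite B"
        "real (card B) \<le> (2 ^ K) powr (1 + \<beta> - 2 * \<alpha> + 5 * \<epsilon>)"
        "dyadic_large_set d a \<alpha> K \<subseteq> (\<Union>l\<in>B. {real l / real L..real (Suc l) / real L})"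
      then have "good K L B"
        by (simp add: good_def)
      then show ?thesis
        by blast
    qed
  qed
  then obtain L B where "\<And>K. K0 \<le> K \<Longrightarrow> good K (L K) (B K)"
    by metis
  then have LB: "(2 ^ K) powr \<beta> \<le> real (L K)" "finite (B K)"
      "real (card (B K)) \<le> (2 ^ K) powr (1 + \<beta> - 2 * \<alpha> + 5 * \<epsilon>)"
      "dyadic_large_set d a \<alpha> K \<subseteq> (\<Union>l\<in>B K. {real l / real (L K)..real (Suc l) / real (L K)})"
    if "K0 \<le> K" for K
    using that unfolding good_def by blast+
  \<comment> \<open>The shift by \<open>K0\<close> puts every index in the range of the eventual
    estimates. Cutting with \<open>{0..1}\<close> keeps the parameters where the Lipschitz bound for
    \<open>moment_point\<close> holds.\<close>
  define V :: "nat \<Rightarrow> nat \<Rightarrow> ((real, 'n) vec) set" where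
    "V K l = moment_point ` ({0..1} \<inter> {real l / real (L (K + K0))..real (Suc l) / real (L (K + K0))})" for K l
  define \<delta> where "\<delta> K = (real d)\<^sup>2 * (2 ^ (K + K0)) powr (-\<beta>)" for K :: nat
  have dist_V: "norm (u - v) \<le> \<delta> K" if uv: "u \<in> V K l" "v \<in> V K l" for u v K l
  proof -
    obtain t s where ts: "t \<in> {0..1}" "s \<in> {0..1}" "u = moment_point t" "v = moment_point s"
        and "t \<in> {real l / real (L (K + K0))..real (Suc l) / real (L (K + K0))}"
          "s \<in> {real l / real (L (K + K0))..real (Suc l) / real (L (K + K0))}"
      using uv unfolding V_def by blast
    then have "\<bar>t - s\<bar> \<le> real (Suc l) / real (L (K + K0)) - real l / real (L (K + K0))"
      unfolding atLeastAtMost_iff by linarith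
    then have "\<bar>t - s\<bar> \<le> 1 / real (L (K + K0))"
      by (simp flip: diff_divide_distrib)
    also have "\<dots> \<le> 1 / (2 ^ (K + K0)) powr \<beta>"
      using LB(1)[of "K + K0"] by (intro frac_le) auto
    finally have "(real d)\<^sup>2 * \<bar>t - s\<bar> \<le> \<delta> K"
      unfolding \<delta>_def powr_minus_divide by (intro mult_left_mono) auto
    then show ?thesis
      using norm_moment_point_diff_le[OF ts(2,1), where 'n = 'n] unfolding d_def ts(3,4) by linarith
  qed
  show ?thesis
  proof (rule hausdorff_measure_limsup_eq_0[where B = "\<lambda>K. B (K + K0)" and V = V and \<delta> = \<delta>])
    show "0 < s" by fact
    show "finite (B (K + K0))" for K
      by (intro LB) simp
    show "bounded (V K l)" for K l
      unfolding bounded_two_points dist_norm using dist_V by blast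
    show "diameter (V K l) \<le> \<delta> K" for K l
      using dist_V by (intro diameter_le) (auto simp: \<delta>_def)
    show "\<delta> \<longlonglongrightarrow> 0"
    proof -
      have "(\<lambda>K. 2 powr (- \<beta> * real K)) \<longlonglongrightarrow> 0"
        using \<open>0 < \<beta>\<close> by real_asymp
      then have "(\<lambda>K. 2 powr (- \<beta> * real (K + K0))) \<longlonglongrightarrow> 0"
        by (rule LIMSEQ_ignore_initial_segment)
      then show ?thesis
        unfolding \<delta>_def pow by (rule tendsto_mult_right_zero)
    qed
    show "summable (\<lambda>K. real (card (B (K + K0))) * \<delta> K powr s)"
    proof (rule summable_comparison_test')
      have "2 powr (- 2 * \<epsilon>) < 2 powr 0"
        using \<open>0 < \<epsilon>\<close> by (intro powr_less_mono) auto
      then have "summable (\<lambda>K. (2 powr (- 2 * \<epsilon>)) ^ K)"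
        by (intro summable_geometric) auto
      then show "summable (\<lambda>K. (real d)\<^sup>2 powr s * (2 powr (- 2 * \<epsilon>)) ^ (K + K0))"
        by (intro summable_mult summable_ignore_initial_segment)
      fix K :: nat
      let ?x = "(2::real) ^ (K + K0)"
      have "\<delta> K powr s = (real d)\<^sup>2 powr s * ?x powr (- \<beta> * s)"
        by (simp add: \<delta>_def powr_mult powr_powr)
      then have "real (card (B (K + K0))) * \<delta> K powr s
          \<le> ?x powr (1 + \<beta> - 2 * \<alpha> + 5 * \<epsilon>) * ((real d)\<^sup>2 powr s * ?x powr (- \<beta> * s))"
        using LB(3)[of "K + K0"] by (simp add: mult_right_mono)
      also have "\<dots> = (real d)\<^sup>2 powr s * ?x powr (1 + \<beta> - 2 * \<alpha> + 5 * \<epsilon> + - \<beta> * s)"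
        unfolding powr_add[of _ _ "- \<beta> * s"] by simp
      also have "\<dots> \<le> (real d)\<^sup>2 powr s * ?x powr (- 2 * \<epsilon>)"
      proof (intro mult_left_mono powr_mono)
        have "1 + \<beta> - 2 * \<alpha> + 5 * \<epsilon> + - \<beta> * s =
            1 - 2 * \<alpha> + (1 - s) * (real d + 1 - \<alpha>) + 5 * \<epsilon> + 3 * \<epsilon> * (1 - s)"
          by (simp add: \<beta>_def algebra_simps)
        also have "\<dots> = - 2 * \<epsilon> - 3 * \<epsilon> * s"
          unfolding \<epsilon>_def by (simp add: field_simps)
        also have "\<dots> \<le> - 2 * \<epsilon>"
          using \<open>0 < \<epsilon>\<close> \<open>0 < s\<close> by simp
        finally show "1 + \<beta> - 2 * \<alpha> + 5 * \<epsilon> + - \<beta> * s \<le> - 2 * \<epsilon>" .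
      qed auto
      also have "?x powr (- 2 * \<epsilon>) = (2 powr (- 2 * \<epsilon>)) ^ (K + K0)"
        unfolding pow by (simp add: powr_power mult.commute)
      finally show "norm (real (card (B (K + K0))) * \<delta> K powr s)
          \<le> (real d)\<^sup>2 powr s * (2 powr (- 2 * \<epsilon>)) ^ (K + K0)"
        by simp
    qed
    show "large_weyl_set a \<alpha> \<inter> moment_curve \<subseteq> (\<Union>K\<in>{m..}. \<Union>l\<in>B (K + K0). V K l)" for m
    proof
      fix x :: "(real, 'n) vec" assume "x \<in> large_weyl_set a \<alpha> \<inter> moment_curve"
      then obtain K t where K: "m + K0 \<le> K" "t \<in> dyadic_large_set d a \<alpha> K" "x = moment_point t"
        using large_weyl_set_moment_curve_subset[of a \<alpha> "m + K0", where 'n = 'n] unfolding d_def by auto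
      then obtain l where "l \<in> B K" "t \<in> {real l / real (L K)..real (Suc l) / real (L K)}"
        using LB(4)[of K] by auto
      moreover have "t \<in> {0..1}"
        using K(2) by (simp add: dyadic_large_set_def)
      ultimately have "x \<in> V (K - K0) l" "l \<in> B (K - K0 + K0)" "K - K0 \<in> {m..}"
        using K by (auto simp: V_def)
      then show "x \<in> (\<Union>K\<in>{m..}. \<Union>l\<in>B (K + K0). V K l)"
        by blast
    qed
  qed
qed

theorem theorem2p15:
  fixes a :: "nat \<Rightarrow> complex" and \<alpha> :: real
  assumes "CARD('n) \<ge> 2"
    and "0 < \<alpha>" and "\<alpha> < 1"
    and "subpolynomial a"
  shows "hausdorff_dim (large_weyl_set a \<alpha> \<inter> (moment_curve :: (real ^ ('n::{finite,linorder})) set))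
           \<le> ereal (1 - (2 * \<alpha> - 1) / (real CARD('n) + 1 - \<alpha>))"
proof (rule ereal_le_epsilon2)
  let ?s = "1 - (2 * \<alpha> - 1) / (real CARD('n) + 1 - \<alpha>)"
  have pos: "0 < real CARD('n) + 1 - \<alpha>"
    using assms by simp
  \<comment> \<open>Equivalent to \<open>3 * \<alpha> < d + 2\<close>, where \<open>d\<close> is the
    number of coordinates.\<close>
  then have "0 < ?s"
    using assms by (simp add: field_simps)
  fix e :: real assume "0 < e"
  \<comment> \<open>The cost exponent is affine in the dimension parameter and vanishes at
    \<open>?s\<close>, so any excess \<open>e\<close> makes it negative.\<close>
  have "1 - 2 * \<alpha> + (1 - (?s + e)) * (real CARD('n) + 1 - \<alpha>) = - (e * (real CARD('n) + 1 - \<alpha>))"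
    using pos by (simp add: field_simps)
  also have "\<dots> < 0"
    using pos \<open>0 < e\<close> by simp
  finally have neg: "1 - 2 * \<alpha> + (1 - (?s + e)) * (real CARD('n) + 1 - \<alpha>) < 0" .
  have "0 < ?s + e"
    using \<open>0 < ?s\<close> \<open>0 < e\<close> by linarith
  have "hausdorff_measure (?s + e) (large_weyl_set a \<alpha> \<inter> (moment_curve :: ((real, 'n) vec) set)) = 0"
    by (rule hausdorff_measure_large_weyl_set[OF assms(2-4) \<open>0 < ?s + e\<close> neg])
  then show "hausdorff_dim (large_weyl_set a \<alpha> \<inter> (moment_curve :: ((real, 'n) vec) set)) \<le> ereal ?s + ereal e"
    unfolding hausdorff_dim_def using \<open>0 < ?s + e\<close> by (intro INF_lower2[of "?s + e"]) auto
qed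

end
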